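(* Let $\gamma>\tfrac53$ and fix a unit vector $\mathbf n\in\mathbb R^d$. Consider a three-point numerical scheme $$\mathbf W_j^{n+1}-\mathbf W_j^{n}+\tfrac{\Delta t^{(n)}}{\Delta x}\big(\mathbf H(\mathbf W_j^n,\mathbf W_{j+1}^n,\mathbf n)-\mathbf H(\mathbf W_{j-1}^n,\mathbf W_j^n,\mathbf n)\big)=0,\qquad j\in\mathbb Z,\ n\ge 0,$$ for the homogeneous energy relaxation system $\partial_t\mathbf w+\nabla\cdot\mathbf g(\mathbf w)=0$, where the numerical flux $\mathbf H$ is Lipschitz continuous, consistent ($\mathbf H(\mathbf w,\mathbf w,\mathbf n)=\mathbf g(\mathbf w)\cdot\mathbf n$ for all $\mathbf w\in\Omega^r$) and conservative ($\mathbf H(\mathbf w^-,\mathbf w^+,\mathbf n)=-\mathbf H(\mathbf w^+,\mathbf w^-,-\mathbf n)$ for all $\mathbf w^\pm\in\Omega^r$). Assume that, under some condition on the time step, the scheme has the following properties for all data $\mathbf W^n_{j\in\mathbb Z}\in\Omega^r$: (a) (entropy stability) $\rho\zeta(\mathbf W_j^{n+1})\le\rho\zeta(\mathbf W_j^n)-\tfrac{\Delta t^{(n)}}{\Delta x}\big(Z(\mathbf W_j^n,\mathbf W_{j+1}^n,\mathbf n)-Z(\mathbf W_{j-1}^n,\mathbf W_j^n,\mathbf n)\big)$ for some numerical flux $Z$ that is consistent, $Z(\mathbf w,\mathbf w,\mathbf n)=\rho\zeta(\mathbf w)\,\mathbf v\cdot\mathbf n$; (b) (maximum principle on mass fractions)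 $\min(Y_{\alpha_{j-1}}^n,Y_{\alpha_j}^n,Y_{\alpha_{j+1}}^n)\le Y_{\alpha_j}^{n+1}\le\max(Y_{\alpha_{j-1}}^n,Y_{\alpha_j}^n,Y_{\alpha_{j+1}}^n)$ for all $1\le\alpha\le n_s$; (c) (maximum principle on the specific entropy) $\zeta(\mathbf W_j^{n+1})\le\max\big(\zeta(\mathbf W_{j-1}^n),\zeta(\mathbf W_j^n),\zeta(\mathbf W_{j+1}^n)\big)$; (d) (robustness) $\mathbf W_j^{n+1}\in\Omega^r$ for all $j\in\mathbb Z$. Define, for $\mathbf u^\pm\in\Omega^a$, $$\mathbf h(\mathbf u^-,\mathbf u^+,\mathbf n)=\mathcal L\,\mathbf H\big(\mathcal P(\mathbf u^-),\mathcal P(\mathbf u^+),\mathbf n\big),$$ that is, denoting by a subscript the component of the flux associated with a given conserved variable and evaluating every component of $\mathbf H$ at $(\mathcal P(\mathbf u^-),\mathcal P(\mathbf u^+),\mathbf n)$: $h_{\rho_\alpha}=H_{\rho_\alpha}$, $h_{\rho\mathbf v}=H_{\rho\mathbf v}$, $h_{\rho_\beta e_\beta^v}=H_{\rho_\beta e_\beta^v}$, and $$h_{\rho E}=H_{\rho E_r}+H_{\rho e_s}+\sum_{\alpha=1}^{n_s}h_\alpha^0H_{\rho_\alpha}+\sum_{\beta=1}^{n_d}H_{\rho_\beta e_\beta^v}.$$ Then $\mathbf h$ is Lipschitz continuous, consistent ($\mathbf h(\mathbf u,\mathbf u,\mathbf n)=\mathbf f(\mathbf u)\cdot\mathbf n$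 for all $\mathbf u\in\Omega^a$) and conservative ($\mathbf h(\mathbf u^-,\mathbf u^+,\mathbf n)=-\mathbf h(\mathbf u^+,\mathbf u^-,-\mathbf n)$ for all $\mathbf u^\pm\in\Omega^a$), and, under the time step condition for the relaxation scheme with data $\mathbf W_j^n=\mathcal P(\mathbf U_j^n)$, the three-point scheme $$\mathbf U_j^{n+1}-\mathbf U_j^{n}+\tfrac{\Delta t^{(n)}}{\Delta x}\big(\mathbf h(\mathbf U_j^n,\mathbf U_{j+1}^n,\mathbf n)-\mathbf h(\mathbf U_{j-1}^n,\mathbf U_j^n,\mathbf n)\big)=0$$ with data $\mathbf U^n_{j\in\mathbb Z}\in\Omega^a$ satisfies: (i) (entropy stability for the pair $(\eta,\mathbf q)$) $\eta(\mathbf U_j^{n+1})-\eta(\mathbf U_j^n)+\tfrac{\Delta t^{(n)}}{\Delta x}\big(Q(\mathbf U_j^n,\mathbf U_{j+1}^n,\mathbf n)-Q(\mathbf U_{j-1}^n,\mathbf U_j^n,\mathbf n)\big)\le0$ with $Q(\mathbf u^-,\mathbf u^+,\mathbf n)=Z\big(\mathcal P(\mathbf u^-),\mathcal P(\mathbf u^+),\mathbf n\big)$, which is consistent: $Q(\mathbf u,\mathbf u,\mathbf n)=\mathbf q(\mathbf u)\cdot\mathbf n$; (ii) $\min(Y_{\alpha_{j-1}}^n,Y_{\alpha_j}^n,Y_{\alpha_{j+1}}^n)\le Y_{\alpha_j}^{n+1}\le\max(Y_{\alpha_{j-1}}^n,Y_{\alpha_j}^n,Y_{\alpha_{j+1}}^n)$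 for all $1\le\alpha\le n_s$; (iii) $\mathrm s(\mathbf U_j^{n+1})\ge\min\big(\mathrm s(\mathbf U_{j-1}^n),\mathrm s(\mathbf U_j^n),\mathrm s(\mathbf U_{j+1}^n)\big)$; (iv) (robustness) $\mathbf U_j^{n+1}\in\Omega^a$ for all $j\in\mathbb Z$.
   Context: **Mixture.** Integers $d\ge1$, $1\le n_d\le n_s$. There are $n_s$ species; species $\alpha$ has gas constant $r_\alpha>0$, formation enthalpy $h_\alpha^0\ge0$, and $C_{v_\alpha}^t=\tfrac32r_\alpha$ (monoatomic) or $\tfrac52r_\alpha$ (diatomic). Species $1,\dots,n_d$ are diatomic species in thermal nonequilibrium, with constants $\vartheta_\beta^v>0$ and vibration energies $e_\beta^v$. Notation: partial densities $\rho_\alpha$, $\boldsymbol\rho=(\rho_1,\dots,\rho_{n_s})$, $\rho=\sum_\alpha\rho_\alpha$, $Y_\alpha=\rho_\alpha/\rho$ (so $\sum_\alpha Y_\alpha=1$), $\tau=1/\rho$, velocity $\mathbf v\in\mathbb R^d$, $e_c=\tfrac12|\mathbf v|^2$, $h_0=\sum_\alpha Y_\alpha h_\alpha^0$, $e_v=\sum_{\beta\le n_d}Y_\beta e_\beta^v$, $\mathbf e_v=(e_\beta^v)_{\beta\le n_d}$, $r(\mathbf Y)=\sum_\alpha Y_\alpha r_\alpha$, $C_{v_t}(\mathbf Y)=\sum_\alpha Y_\alpha C_{v_\alpha}^t$, $\gamma(\mathbf Y)=1+r(\mathbf Y)/C_{v_t}(\mathbf Y)\in[\tfrac75,\tfrac53]$.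 **Multicomponent Euler system.** $\partial_t\mathbf u+\nabla\cdot\mathbf f(\mathbf u)=0$ with $\mathbf u=(\boldsymbol\rho,\rho\mathbf v,\rho E,(\rho_\beta e_\beta^v)_{\beta\le n_d})$, $E=h_0+e_t+e_v+e_c$ ($e_t$ is the translation-rotation energy), pressure $\mathrm p=(\gamma(\mathbf Y)-1)\rho e_t$, and $\mathbf f(\mathbf u)\cdot\mathbf n=\big(\boldsymbol\rho\,\mathbf v\cdot\mathbf n,\ \rho(\mathbf v\cdot\mathbf n)\mathbf v+\mathrm p\mathbf n,\ (\rho E+\mathrm p)\mathbf v\cdot\mathbf n,\ (\rho_\beta e_\beta^v\,\mathbf v\cdot\mathbf n)_\beta\big)$. State set: $\Omega^a=\{\mathbf u:\rho_\alpha>0\ \forall\alpha,\ \mathbf v\in\mathbb R^d,\ e_t>0,\ e_\beta^v>0\ \forall\beta\}$. **Mixture entropy.** $\mathrm s(\mathbf Y,\tau,e_t,\mathbf e_v)=C_{v_t}(\mathbf Y)\ln e_t+r(\mathbf Y)\ln\tau+K(\mathbf Y)+\sum_{\beta\le n_d}Y_\beta\mathrm s_\beta^v(e_\beta^v)$, with $K(\mathbf Y)=\sum_\alpha Y_\alpha\big(C_{v_\alpha}^t\ln\tfrac{C_{v_\alpha}^t}{C_{v_t}(\mathbf Y)}-r_\alpha\ln Y_\alpha\big)$ and $\mathrm s_\beta^v(e)=r_\beta\ln e+r_\beta\big(1+\tfrac{e}{r_\beta\vartheta_\beta^v}\big)\ln\big(1+\tfrac{r_\beta\vartheta_\beta^v}{e}\big)$.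 Write $\mathrm s(\mathbf u)$ for its value at the state $\mathbf u$, and $\eta(\mathbf u)=-\rho\,\mathrm s(\mathbf u)$; the entropy flux is $\mathbf q(\mathbf u)=-\rho\,\mathrm s(\mathbf u)\mathbf v$. **Energy relaxation system (homogeneous form).** $\partial_t\mathbf w+\nabla\cdot\mathbf g(\mathbf w)=0$, $\mathbf w=(\boldsymbol\rho,\rho\mathbf v,\rho E_r,(\rho_\beta e_\beta^v)_{\beta\le n_d},\rho e_s)$, $e_r=E_r-e_c$, $\mathrm p_r=(\gamma-1)\rho e_r$, $\mathbf g(\mathbf w)\cdot\mathbf n=\big(\boldsymbol\rho\,\mathbf v\cdot\mathbf n,\ \rho(\mathbf v\cdot\mathbf n)\mathbf v+\mathrm p_r\mathbf n,\ (\rho E_r+\mathrm p_r)\mathbf v\cdot\mathbf n,\ (\rho_\beta e_\beta^v\,\mathbf v\cdot\mathbf n)_\beta,\ \rho e_s\,\mathbf v\cdot\mathbf n\big)$. State set: $\Omega^r=\{\mathbf w:\rho_\alpha>0\ \forall\alpha,\ \mathbf v\in\mathbb R^d,\ e_r>0,\ e_\beta^v>0\ \forall\beta,\ e_s>0\}$. **Relaxation entropy.** $\zeta(\mathbf w)=-\mathrm s\big(\mathbf Y,\mathcal T,\mathcal E+e_s,\mathbf e_v\big)$, where $\mathcal E=\tfrac{\gamma(\mathbf Y)-1}{\gamma-\gamma(\mathbf Y)}e_s$, $\mathcal T=\big(\tfrac{\gamma-\gamma(\mathbf Y)}{\gamma(\mathbf Y)-1}\tfrac{(-\mathrm s_r)^\gamma}{e_s}\big)^{1/(\gamma-1)}$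 and $\mathrm s_r=-(\tau^{\gamma-1}e_r)^{1/\gamma}$. **Operators.** $\mathcal L$ is the linear map $\mathcal L\mathbf w=\big(\boldsymbol\rho,\rho\mathbf v,\rho E_r+\rho e_s+\sum_\alpha h_\alpha^0\rho_\alpha+\sum_\beta\rho_\beta e_\beta^v,(\rho_\beta e_\beta^v)_\beta\big)$ (applied to flux vectors by the same linear formula). $\mathcal P:\Omega^a\to\Omega^r$ is $\mathcal P(\mathbf u)=\big(\boldsymbol\rho,\rho\mathbf v,\rho e_r+\rho e_c,(\rho_\beta e_\beta^v)_\beta,\rho(e_t-e_r)\big)$ with $e_r=\tfrac{\mathrm p}{(\gamma-1)\rho}=\tfrac{\gamma(\mathbf Y)-1}{\gamma-1}e_t$. $\Delta x>0$, $\Delta t^{(n)}>0$ are the space and time steps; $Y_{\alpha_j}^n$ is the mass fraction of species $\alpha$ in the $j$th cell state at time level $n$. *)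

theory Defs
  imports "HOL-Analysis.Analysis"
begin

section \<open>Mixture\<close>

text \<open>
  The species are the elements of a finite type \<open>'s\<close>, so \<open>n_s = CARD('s)\<close>. The species in thermal
  nonequilibrium are indexed by a finite type \<open>'b\<close>, so \<open>n_d = CARD('b)\<close>, and \<open>vib_species\<close> tells
  which species carries the index \<open>\<beta>\<close>; it replaces the convention that these are the first \<open>n_d\<close>
  species, and its injectivity gives \<open>n_d \<le> n_s\<close>. Species outside \<open>diatomic\<close> are monoatomic.
\<close>

record ('s, 'b) mixture =
  gas_const :: "'s \<Rightarrow> real"
  form_enthalpy :: "'s \<Rightarrow> real"
  diatomic :: "'s set"
  vib_species :: "'b \<Rightarrow> 's"
  vib_temp :: "'b \<Rightarrow> real"

definition valid_mixture :: "('s::finite, 'b::finite) mixture \<Rightarrow> bool" where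
  "valid_mixture M \<longleftrightarrow>
     (\<forall>\<alpha>. gas_const M \<alpha> > 0) \<and> (\<forall>\<alpha>. form_enthalpy M \<alpha> \<ge> 0) \<and>
     (\<forall>\<beta>. vib_temp M \<beta> > 0) \<and>
     inj (vib_species M) \<and> range (vib_species M) \<subseteq> diatomic M"

definition Cv_species :: "('s::finite, 'b::finite) mixture \<Rightarrow> 's \<Rightarrow> real" where
  "Cv_species M \<alpha> = (if \<alpha> \<in> diatomic M then 5/2 else 3/2) * gas_const M \<alpha>"

definition r_mix :: "('s::finite, 'b::finite) mixture \<Rightarrow> real^'s \<Rightarrow> real" where
  "r_mix M Y = (\<Sum>\<alpha>\<in>UNIV. Y $ \<alpha> * gas_const M \<alpha>)"

definition Cv_mix :: "('s::finite, 'b::finite) mixture \<Rightarrow> real^'s \<Rightarrow> real" where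
  "Cv_mix M Y = (\<Sum>\<alpha>\<in>UNIV. Y $ \<alpha> * Cv_species M \<alpha>)"

definition gamma_mix :: "('s::finite, 'b::finite) mixture \<Rightarrow> real^'s \<Rightarrow> real" where
  "gamma_mix M Y = 1 + r_mix M Y / Cv_mix M Y"

definition K_mix :: "('s::finite, 'b::finite) mixture \<Rightarrow> real^'s \<Rightarrow> real" where
  "K_mix M Y = (\<Sum>\<alpha>\<in>UNIV. Y $ \<alpha> *
     (Cv_species M \<alpha> * ln (Cv_species M \<alpha> / Cv_mix M Y) - gas_const M \<alpha> * ln (Y $ \<alpha>)))"

definition vib_entropy :: "('s::finite, 'b::finite) mixture \<Rightarrow> 'b \<Rightarrow> real \<Rightarrow> real" where
  "vib_entropy M \<beta> e =
     (let r = gas_const M (vib_species M \<beta>); \<theta> = vib_temp M \<beta>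
      in r * ln e + r * (1 + e / (r * \<theta>)) * ln (1 + r * \<theta> / e))"

definition mixture_entropy ::
  "('s::finite, 'b::finite) mixture \<Rightarrow> real^'s \<Rightarrow> real \<Rightarrow> real \<Rightarrow> real^'b \<Rightarrow> real" where
  "mixture_entropy M Y \<tau> e\<^sub>t e\<^sub>v =
     Cv_mix M Y * ln e\<^sub>t + r_mix M Y * ln \<tau> + K_mix M Y
     + (\<Sum>\<beta>\<in>UNIV. Y $ vib_species M \<beta> * vib_entropy M \<beta> (e\<^sub>v $ \<beta>))"

section \<open>States\<close>

text \<open>
  An Euler state is \<open>(\<rho>\<^sub>\<alpha>, \<rho>v, \<rho>E, \<rho>\<^sub>\<beta>e\<^sub>\<beta>)\<close> and a relaxation state is
  \<open>(\<rho>\<^sub>\<alpha>, \<rho>v, \<rho>E\<^sub>r, \<rho>\<^sub>\<beta>e\<^sub>\<beta>, \<rho>e\<^sub>s)\<close>, all in conserved variables; fluxes in a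
  fixed direction are elements of the same spaces. Below, \<open>R\<close> is the vector of partial densities,
  \<open>m\<close> the momentum, and \<open>En\<close>, \<open>V\<close>, \<open>S\<close> the remaining components.
\<close>

type_synonym ('s, 'd, 'b) euler_state = "(real^'s) \<times> (real^'d) \<times> real \<times> (real^'b)"
type_synonym ('s, 'd, 'b) relax_state = "(real^'s) \<times> (real^'d) \<times> real \<times> (real^'b) \<times> real"

definition total_density :: "real^'s::finite \<Rightarrow> real" where
  "total_density R = (\<Sum>\<alpha>\<in>UNIV. R $ \<alpha>)"

definition mass_frac :: "real^'s::finite \<Rightarrow> real^'s" where
  "mass_frac R = (\<chi> \<alpha>. R $ \<alpha> / total_density R)"

definition velocity :: "real^'s::finite \<Rightarrow> real^'d::finite \<Rightarrow> real^'d" where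
  "velocity R m = m /\<^sub>R total_density R"

definition kinetic_energy :: "real^'s::finite \<Rightarrow> real^'d::finite \<Rightarrow> real" where
  "kinetic_energy R m = (norm (velocity R m))\<^sup>2 / 2"

definition vib_energies :: "('s::finite, 'b::finite) mixture \<Rightarrow> real^'s \<Rightarrow> real^'b \<Rightarrow> real^'b" where
  "vib_energies M R V = (\<chi> \<beta>. V $ \<beta> / R $ vib_species M \<beta>)"

section \<open>Multicomponent Euler system\<close>

text \<open>The translation-rotation energy, from \<open>E = h\<^sub>0 + e\<^sub>t + e\<^sub>v + e\<^sub>c\<close>.\<close>

fun e_trans :: "('s::finite, 'b::finite) mixture \<Rightarrow> ('s, 'd::finite, 'b) euler_state \<Rightarrow> real" where
  "e_trans M (R, m, En, V) =
     En / total_density R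
     - (\<Sum>\<alpha>\<in>UNIV. mass_frac R $ \<alpha> * form_enthalpy M \<alpha>)
     - (\<Sum>\<beta>\<in>UNIV. mass_frac R $ vib_species M \<beta> * vib_energies M R V $ \<beta>)
     - kinetic_energy R m"

fun pressure :: "('s::finite, 'b::finite) mixture \<Rightarrow> ('s, 'd::finite, 'b) euler_state \<Rightarrow> real" where
  "pressure M (R, m, En, V) =
     (gamma_mix M (mass_frac R) - 1) * total_density R * e_trans M (R, m, En, V)"

fun euler_flux :: "('s::finite, 'b::finite) mixture \<Rightarrow> ('s, 'd::finite, 'b) euler_state \<Rightarrow> real^'d
    \<Rightarrow> ('s, 'd, 'b) euler_state" where
  "euler_flux M (R, m, En, V) n =
     (let v = velocity R m; p = pressure M (R, m, En, V)
      in ((v \<bullet> n) *\<^sub>R R,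
          (total_density R * (v \<bullet> n)) *\<^sub>R v + p *\<^sub>R n,
          (En + p) * (v \<bullet> n),
          (v \<bullet> n) *\<^sub>R V))"

definition Omega_a ::
    "('s::finite, 'b::finite) mixture \<Rightarrow> ('s, 'd::finite, 'b) euler_state set" where
  "Omega_a M = {(R, m, En, V). (\<forall>\<alpha>. R $ \<alpha> > 0) \<and> e_trans M (R, m, En, V) > 0
                  \<and> (\<forall>\<beta>. vib_energies M R V $ \<beta> > 0)}"

fun spec_entropy ::
    "('s::finite, 'b::finite) mixture \<Rightarrow> ('s, 'd::finite, 'b) euler_state \<Rightarrow> real" where
  "spec_entropy M (R, m, En, V) =
     mixture_entropy M (mass_frac R) (1 / total_density R) (e_trans M (R, m, En, V))
       (vib_energies M R V)"

definition eta ::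
    "('s::finite, 'b::finite) mixture \<Rightarrow> ('s, 'd::finite, 'b) euler_state \<Rightarrow> real" where
  "eta M u = - total_density (fst u) * spec_entropy M u"

definition entropy_flux ::
    "('s::finite, 'b::finite) mixture \<Rightarrow> ('s, 'd::finite, 'b) euler_state \<Rightarrow> real^'d" where
  "entropy_flux M u = (- total_density (fst u) * spec_entropy M u) *\<^sub>R velocity (fst u) (fst (snd u))"

section \<open>Energy relaxation system\<close>

fun e_relax :: "('s::finite, 'd::finite, 'b::finite) relax_state \<Rightarrow> real" where
  "e_relax (R, m, En, V, S) = En / total_density R - kinetic_energy R m"

fun relax_flux :: "real \<Rightarrow> ('s::finite, 'd::finite, 'b::finite) relax_state \<Rightarrow> real^'d
    \<Rightarrow> ('s, 'd, 'b) relax_state" where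
  "relax_flux \<gamma> (R, m, En, V, S) n =
     (let v = velocity R m; p = (\<gamma> - 1) * total_density R * e_relax (R, m, En, V, S)
      in ((v \<bullet> n) *\<^sub>R R,
          (total_density R * (v \<bullet> n)) *\<^sub>R v + p *\<^sub>R n,
          (En + p) * (v \<bullet> n),
          (v \<bullet> n) *\<^sub>R V,
          S * (v \<bullet> n)))"

definition Omega_r ::
    "('s::finite, 'b::finite) mixture \<Rightarrow> ('s, 'd::finite, 'b) relax_state set" where
  "Omega_r M = {(R, m, En, V, S). (\<forall>\<alpha>. R $ \<alpha> > 0) \<and> e_relax (R, m, En, V, S) > 0
                  \<and> (\<forall>\<beta>. vib_energies M R V $ \<beta> > 0) \<and> S / total_density R > 0}"

fun relax_entropy ::
    "('s::finite, 'b::finite) mixture \<Rightarrow> real \<Rightarrow> ('s, 'd::finite, 'b) relax_state \<Rightarrow> real" where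
  "relax_entropy M \<gamma> (R, m, En, V, S) =
     (let Y = mass_frac R; g = gamma_mix M Y; \<tau> = 1 / total_density R;
          e\<^sub>s = S / total_density R; e\<^sub>r = e_relax (R, m, En, V, S);
          s\<^sub>r = - ((\<tau> powr (\<gamma> - 1) * e\<^sub>r) powr (1 / \<gamma>));
          \<T> = ((\<gamma> - g) / (g - 1) * ((- s\<^sub>r) powr \<gamma> / e\<^sub>s)) powr (1 / (\<gamma> - 1));
          \<E> = (g - 1) / (\<gamma> - g) * e\<^sub>s
      in - mixture_entropy M Y \<T> (\<E> + e\<^sub>s) (vib_energies M R V))"

section \<open>The maps between the two systems\<close>

fun L_op :: "('s::finite, 'b::finite) mixture \<Rightarrow> ('s, 'd::finite, 'b) relax_state
    \<Rightarrow> ('s, 'd, 'b) euler_state" where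
  "L_op M (R, m, En, V, S) =
     (R, m, En + S + (\<Sum>\<alpha>\<in>UNIV. form_enthalpy M \<alpha> * R $ \<alpha>) + (\<Sum>\<beta>\<in>UNIV. V $ \<beta>), V)"

fun P_op :: "('s::finite, 'b::finite) mixture \<Rightarrow> real \<Rightarrow> ('s, 'd::finite, 'b) euler_state
    \<Rightarrow> ('s, 'd, 'b) relax_state" where
  "P_op M \<gamma> (R, m, En, V) =
     (let \<rho> = total_density R; e\<^sub>t = e_trans M (R, m, En, V);
          e\<^sub>r = pressure M (R, m, En, V) / ((\<gamma> - 1) * \<rho>)
      in (R, m, \<rho> * e\<^sub>r + \<rho> * kinetic_energy R m, V, \<rho> * (e\<^sub>t - e\<^sub>r)))"

section \<open>Three-point schemes\<close>

text \<open>
  Lipschitz continuity of a numerical flux is understood locally, jointly in the two states. A global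
  Lipschitz bound on the state set is impossible for any consistent numerical flux: at fixed partial
  densities and internal energies the energy flux \<open>(\<rho>E + p) v \<bullet> n\<close> grows like \<open>|v|^3\<close>,
  the state only like \<open>|v|^2\<close>.
\<close>

definition locally_lipschitz_on :: "'a::metric_space set \<Rightarrow> ('a \<Rightarrow> 'b::metric_space) \<Rightarrow> bool" where
  "locally_lipschitz_on X f \<longleftrightarrow> (\<forall>x\<in>X. \<exists>\<epsilon>>0. \<exists>C. C-lipschitz_on (cball x \<epsilon> \<inter> X) f)"

definition lipschitz_flux :: "'a::metric_space set \<Rightarrow> ('a \<Rightarrow> 'a \<Rightarrow> 'n \<Rightarrow> 'b::metric_space) \<Rightarrow> 'n \<Rightarrow> bool"
  where "lipschitz_flux \<Omega> F n \<longleftrightarrow> locally_lipschitz_on (\<Omega> \<times> \<Omega>) (\<lambda>(a, b). F a b n)"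

definition consistent_flux :: "'a set \<Rightarrow> ('a \<Rightarrow> 'n \<Rightarrow> 'b) \<Rightarrow> ('a \<Rightarrow> 'a \<Rightarrow> 'n \<Rightarrow> 'b) \<Rightarrow> 'n \<Rightarrow> bool" where
  "consistent_flux \<Omega> f F n \<longleftrightarrow> (\<forall>a\<in>\<Omega>. F a a n = f a n)"

definition conservative_flux :: "'a set \<Rightarrow> ('a \<Rightarrow> 'a \<Rightarrow> 'n::uminus \<Rightarrow> 'b::uminus) \<Rightarrow> 'n \<Rightarrow> bool" where
  "conservative_flux \<Omega> F n \<longleftrightarrow> (\<forall>a\<in>\<Omega>. \<forall>b\<in>\<Omega>. F a b n = - F b a (- n))"

definition scheme_step ::
  "real \<Rightarrow> real \<Rightarrow> ('a::real_vector \<Rightarrow> 'a \<Rightarrow> 'n \<Rightarrow> 'a) \<Rightarrow> 'n \<Rightarrow> (int \<Rightarrow> 'a) \<Rightarrow> (int \<Rightarrow> 'a) \<Rightarrow> bool" where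
  "scheme_step \<Delta>x \<Delta>t F n A A' \<longleftrightarrow>
     (\<forall>j. A' j - A j + (\<Delta>t / \<Delta>x) *\<^sub>R (F (A j) (A (j + 1)) n - F (A (j - 1)) (A j) n) = 0)"

definition induced_flux :: "('s::finite, 'b::finite) mixture \<Rightarrow> real \<Rightarrow>
  (('s, 'd::finite, 'b) relax_state \<Rightarrow> ('s, 'd, 'b) relax_state \<Rightarrow> real^'d \<Rightarrow> ('s, 'd, 'b) relax_state)
  \<Rightarrow> ('s, 'd, 'b) euler_state \<Rightarrow> ('s, 'd, 'b) euler_state \<Rightarrow> real^'d \<Rightarrow> ('s, 'd, 'b) euler_state" where
  "induced_flux M \<gamma> H a b n = L_op M (H (P_op M \<gamma> a) (P_op M \<gamma> b) n)"

definition induced_entropy_flux :: "('s::finite, 'b::finite) mixture \<Rightarrow> real \<Rightarrow>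
  (('s, 'd::finite, 'b) relax_state \<Rightarrow> ('s, 'd, 'b) relax_state \<Rightarrow> real^'d \<Rightarrow> real)
  \<Rightarrow> ('s, 'd, 'b) euler_state \<Rightarrow> ('s, 'd, 'b) euler_state \<Rightarrow> real^'d \<Rightarrow> real" where
  "induced_entropy_flux M \<gamma> Z a b n = Z (P_op M \<gamma> a) (P_op M \<gamma> b) n"

end

theory Submission
  imports Defs
begin

text \<open>
  The linear map \<open>\<L>\<close> is a left inverse of \<open>\<P>\<close> and carries the relaxation flux at \<open>\<P>(u)\<close> to the Euler
  flux at \<open>u\<close>, so \<open>\<L>\<close> maps one relaxation step started from \<open>\<P>(U\<^sub>j)\<close> to one Euler step started from
  \<open>U\<^sub>j\<close>. With \<open>\<theta> = (\<gamma>(Y) - 1) / (\<gamma> - 1) \<in> (0, 1)\<close> and \<open>e = e\<^sub>r + e\<^sub>s\<close>, the two entropies differ by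
  \<open>- \<zeta>(w) - s(\<L> w) = C\<^sub>v ((1 - \<theta>) ln (e\<^sub>s / ((1 - \<theta>) e)) + \<theta> ln (e\<^sub>r / (\<theta> e)))\<close>,
  which is nonpositive by \<open>ln x \<le> x - 1\<close> and vanishes at \<open>w = \<P>(u)\<close>. Hence the entropy inequality and
  the entropy maximum principle pass from the relaxation scheme to the Euler scheme.
\<close>

section \<open>Local Lipschitz continuity\<close>

lemma locally_lipschitz_onE:
  assumes "locally_lipschitz_on X f" "x \<in> X"
  obtains \<epsilon> C where "\<epsilon> > 0" "C \<ge> 0" "C-lipschitz_on (cball x \<epsilon> \<inter> X) f"
  using assms lipschitz_on_nonneg unfolding locally_lipschitz_on_def by metis

lemma locally_lipschitz_on_cong:
  assumes "locally_lipschitz_on X f" "\<And>x. x \<in> X \<Longrightarrow> f x = g x"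
  shows "locally_lipschitz_on X g"
  using assms unfolding locally_lipschitz_on_def lipschitz_on_def by (metis IntE)

lemma locally_lipschitz_on_lipschitz:
  assumes "C-lipschitz_on X f"
  shows "locally_lipschitz_on X f"
  unfolding locally_lipschitz_on_def
  using assms by (meson lipschitz_on_subset inf_le2 zero_less_one)

lemma locally_lipschitz_on_compose:
  assumes g: "locally_lipschitz_on Y g" and f: "locally_lipschitz_on X f" and sub: "f ` X \<subseteq> Y"
  shows "locally_lipschitz_on X (\<lambda>x. g (f x))"
  unfolding locally_lipschitz_on_def
proof
  fix x assume x: "x \<in> X"
  obtain \<epsilon> C where e: "\<epsilon> > 0" "C \<ge> 0" "C-lipschitz_on (cball x \<epsilon> \<inter> X) f"
    using locally_lipschitz_onE[OF f x] .
  obtain \<delta> D where d: "\<delta> > 0" "D \<ge> 0" "D-lipschitz_on (cball (f x) \<delta> \<inter> Y) g"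
    using locally_lipschitz_onE[OF g] x sub by blast
  \<comment> \<open>The second bound makes \<open>f\<close> send the smaller ball into the
    \<delta>-ball on which \<open>g\<close> is Lipschitz. Dividing by C + 1 rather than C covers C =
    0.\<close>
  define \<epsilon>' where "\<epsilon>' = min \<epsilon> (\<delta> / (C + 1))"
  have e': "\<epsilon>' > 0" using e d by (simp add: \<epsilon>'_def)
  have lf: "C-lipschitz_on (cball x \<epsilon>' \<inter> X) f"
    by (rule lipschitz_on_subset[OF e(3)]) (auto simp: \<epsilon>'_def)
  have "f ` (cball x \<epsilon>' \<inter> X) \<subseteq> cball (f x) \<delta> \<inter> Y"
  proof clarify
    fix y assume y: "y \<in> cball x \<epsilon>'" "y \<in> X"
    have "dist (f x) (f y) \<le> C * dist x y"
      using lipschitz_onD[OF lf, of x y] x y e' by auto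
    also have "\<dots> \<le> (C + 1) * (\<delta> / (C + 1))"
      using y e d by (intro mult_mono) (auto simp: \<epsilon>'_def)
    also have "\<dots> = \<delta>" using e by simp
    finally show "f y \<in> cball (f x) \<delta> \<inter> Y" using y sub by auto
  qed
  then have "D-lipschitz_on (f ` (cball x \<epsilon>' \<inter> X)) g"
    by (rule lipschitz_on_subset[OF d(3)])
  from lipschitz_on_compose2[OF lf this]
  show "\<exists>\<epsilon>>0. \<exists>C. C-lipschitz_on (cball x \<epsilon> \<inter> X) (\<lambda>x. g (f x))"
    using e' by blast
qed

lemma locally_lipschitz_on_Pair:
  assumes f: "locally_lipschitz_on X f" and g: "locally_lipschitz_on X g"
  shows "locally_lipschitz_on X (\<lambda>x. (f x, g x))"
  unfolding locally_lipschitz_on_def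
proof
  fix x assume x: "x \<in> X"
  obtain \<epsilon> C where e: "\<epsilon> > 0" "C-lipschitz_on (cball x \<epsilon> \<inter> X) f"
    using locally_lipschitz_onE[OF f x] by metis
  obtain \<delta> D where d: "\<delta> > 0" "D-lipschitz_on (cball x \<delta> \<inter> X) g"
    using locally_lipschitz_onE[OF g x] by metis
  have "C-lipschitz_on (cball x (min \<epsilon> \<delta>) \<inter> X) f" "D-lipschitz_on (cball x (min \<epsilon> \<delta>) \<inter> X) g"
    by (rule lipschitz_on_subset[OF e(2)], force) (rule lipschitz_on_subset[OF d(2)], force)
  from lipschitz_on_Pair[OF this]
  show "\<exists>\<epsilon>>0. \<exists>C. C-lipschitz_on (cball x \<epsilon> \<inter> X) (\<lambda>x. (f x, g x))"
    using e d by (intro exI[of _ "min \<epsilon> \<delta>"]) auto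
qed

section \<open>Building blocks: linear maps, products and reciprocals\<close>

lemma locally_lipschitz_on_bounded_linear:
  assumes "bounded_linear f"
  shows "locally_lipschitz_on X f"
proof -
  obtain B where "B-lipschitz_on X f"
    using bounded_linear.lipschitz_boundE[OF assms] .
  then show ?thesis by (rule locally_lipschitz_on_lipschitz)
qed

lemma locally_lipschitz_on_linear:
  fixes f :: "'a::euclidean_space \<Rightarrow> 'b::euclidean_space"
  assumes "linear f"
  shows "locally_lipschitz_on X f"
  using assms locally_lipschitz_on_bounded_linear linear_conv_bounded_linear by blast

lemma locally_lipschitz_on_const: "locally_lipschitz_on X (\<lambda>_. c)"
  by (rule locally_lipschitz_on_lipschitz[of 0]) (simp add: lipschitz_on_def)

text \<open>A bilinear map is Lipschitz on bounded sets of pairs, hence locally Lipschitz on the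
  whole product space. The claim follows by composing it with the pair of \<open>f\<close> and
  \<open>g\<close>.\<close>

lemma (in bounded_bilinear) locally_lipschitz_on_bilinear:
  assumes f: "locally_lipschitz_on X f" and g: "locally_lipschitz_on X g"
  shows "locally_lipschitz_on X (\<lambda>x. prod (f x) (g x))"
proof -
  obtain K where K: "K > 0" "\<And>a b. norm (prod a b) \<le> norm a * norm b * K"
    using pos_bounded by blast
  have "locally_lipschitz_on UNIV (\<lambda>p. prod (fst p) (snd p))"
    unfolding locally_lipschitz_on_def
  proof
    fix p :: "'a \<times> 'b"
    \<comment> \<open>This bounds the norm of every point of the closed unit ball around
      \<open>p\<close>, and so the norms of its two components.\<close>
    define B where "B = norm p + 1"
    have B: "B > 0" by (simp add: B_def add_nonneg_pos)
    have "(2 * K * B)-lipschitz_on (cball p 1 \<inter> UNIV) (\<lambda>p. prod (fst p) (snd p))"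
    proof (rule lipschitz_onI)
      fix x y assume xy: "x \<in> cball p 1 \<inter> UNIV" "y \<in> cball p 1 \<inter> UNIV"
      have bd: "norm z \<le> B" if "z \<in> cball p 1" for z
        using norm_triangle_sub[of z p] that by (simp add: B_def dist_norm norm_minus_commute)
      have nx: "norm (snd x) \<le> B" "norm (fst y) \<le> B"
        using bd[of x] bd[of y] xy norm_snd_le[of "snd x" "fst x"] norm_fst_le[of "fst y" "snd y"]
        by (auto intro: order_trans)
      have d1: "norm (fst x - fst y) \<le> dist x y" "norm (snd x - snd y) \<le> dist x y"
        by (metis dist_fst_le dist_norm) (metis dist_snd_le dist_norm)
      \<comment> \<open>Changing one factor at a time leaves one small and one bounded factor in
        each term.\<close>
      have "prod (fst x) (snd x) - prod (fst y) (snd y)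
          = prod (fst x - fst y) (snd x) + prod (fst y) (snd x - snd y)"
        by (simp add: diff_left diff_right)
      then have "dist (prod (fst x) (snd x)) (prod (fst y) (snd y))
          \<le> norm (fst x - fst y) * norm (snd x) * K + norm (fst y) * norm (snd x - snd y) * K"
        by (metis K(2) add_mono dist_norm norm_triangle_le)
      also have "\<dots> \<le> dist x y * B * K + B * dist x y * K"
        using nx d1 K B by (intro add_mono mult_mono) auto
      finally show "dist (prod (fst x) (snd x)) (prod (fst y) (snd y)) \<le> 2 * K * B * dist x y"
        by (simp add: algebra_simps)
    qed (use K B in auto)
    then show "\<exists>\<epsilon>>0. \<exists>C. C-lipschitz_on (cball p \<epsilon> \<inter> UNIV) (\<lambda>p. prod (fst p) (snd p))"
      using zero_less_one by blast
  qed
  from locally_lipschitz_on_compose[OF this locally_lipschitz_on_Pair[OF f g]]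
  show ?thesis by simp
qed

lemmas locally_lipschitz_on_mult =
  bounded_bilinear.locally_lipschitz_on_bilinear[OF bounded_bilinear_mult]
lemmas locally_lipschitz_on_inner =
  bounded_bilinear.locally_lipschitz_on_bilinear[OF bounded_bilinear_inner]

lemma locally_lipschitz_on_add:
  fixes f g :: "'a::metric_space \<Rightarrow> 'b::real_normed_vector"
  assumes "locally_lipschitz_on X f" "locally_lipschitz_on X g"
  shows "locally_lipschitz_on X (\<lambda>x. f x + g x)"
proof -
  have "bounded_linear (\<lambda>p::'b \<times> 'b. fst p + snd p)"
    by (intro bounded_linear_intros)
  from locally_lipschitz_on_compose[OF locally_lipschitz_on_bounded_linear[OF this]
      locally_lipschitz_on_Pair[OF assms] subset_UNIV]
  show ?thesis by simp
qed

lemma locally_lipschitz_on_diff: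
  fixes f g :: "'a::metric_space \<Rightarrow> 'b::real_normed_vector"
  assumes "locally_lipschitz_on X f" "locally_lipschitz_on X g"
  shows "locally_lipschitz_on X (\<lambda>x. f x - g x)"
proof -
  have "bounded_linear (\<lambda>p::'b \<times> 'b. fst p - snd p)"
    by (intro bounded_linear_intros)
  from locally_lipschitz_on_compose[OF locally_lipschitz_on_bounded_linear[OF this]
      locally_lipschitz_on_Pair[OF assms] subset_UNIV]
  show ?thesis by simp
qed

lemma locally_lipschitz_on_inverse:
  fixes f :: "'a::metric_space \<Rightarrow> real"
  assumes f: "locally_lipschitz_on X f" and pos: "\<And>x. x \<in> X \<Longrightarrow> f x > 0"
  shows "locally_lipschitz_on X (\<lambda>x. inverse (f x))"
proof -
  have "locally_lipschitz_on {0<..} (inverse :: real \<Rightarrow> real)"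
    unfolding locally_lipschitz_on_def
  proof
    fix x :: real assume "x \<in> {0<..}"
    then have x: "x > 0" by simp
    \<comment> \<open>The radius x/2 keeps both points at or above x/2. Hence 1/(ab) \<le> 4/x^2 in
      the identity |1/a - 1/b| = |b - a|/(ab).\<close>
    have "(4 / x\<^sup>2)-lipschitz_on (cball x (x/2) \<inter> {0<..}) inverse"
    proof (rule lipschitz_onI)
      fix a b assume "a \<in> cball x (x/2) \<inter> {0<..}" "b \<in> cball x (x/2) \<inter> {0<..}"
      then have ab: "a \<ge> x/2" "b \<ge> x/2" "a > 0" "b > 0"
        by (auto simp: dist_real_def abs_if split: if_splits)
      have "(x/2) * (x/2) \<le> a * b" using ab x by (intro mult_mono) auto
      then have "inverse (a * b) \<le> inverse ((x/2) * (x/2))"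
        using x by (intro le_imp_inverse_le) auto
      also have "\<dots> = 4 / x\<^sup>2" by (simp add: power2_eq_square divide_simps)
      finally have le: "inverse (a * b) \<le> 4 / x\<^sup>2" .
      have "inverse a - inverse b = (b - a) * inverse (a * b)"
        using ab by (simp add: field_simps)
      then have "dist (inverse a) (inverse b) = \<bar>b - a\<bar> * inverse (a * b)"
        using ab by (simp add: dist_real_def abs_mult)
      also have "\<dots> \<le> \<bar>b - a\<bar> * (4 / x\<^sup>2)" using le by (intro mult_left_mono) auto
      finally show "dist (inverse a) (inverse b) \<le> 4 / x\<^sup>2 * dist a b"
        by (simp add: dist_real_def abs_minus_commute mult.commute)
    qed simp
    then show "\<exists>\<epsilon>>0. \<exists>C. C-lipschitz_on (cball x \<epsilon> \<inter> {0<..}) inverse"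
      using x half_gt_zero by blast
  qed
  from locally_lipschitz_on_compose[OF this f] pos show ?thesis by force
qed

section \<open>The equilibrium map and its left inverse\<close>

lemma linear_L_op: "linear (L_op M)"
  by (rule linearI) (auto simp: sum.distrib sum_distrib_left algebra_simps)

section \<open>Mixture averages and the range of \<gamma>(Y)\<close>

lemma mixture_sums_mass_frac:
  "r_mix M (mass_frac R) = r_mix M R / total_density R"
  "Cv_mix M (mass_frac R) = Cv_mix M R / total_density R"
  by (simp_all add: r_mix_def Cv_mix_def mass_frac_def sum_divide_distrib)

lemma mass_frac_pos:
  assumes "\<And>\<alpha>. R $ \<alpha> > 0"
  shows "total_density R > 0" "mass_frac R $ \<alpha> > 0"
proof -
  show "total_density R > 0" unfolding total_density_def using assms by (intro sum_pos) auto
  then show "mass_frac R $ \<alpha> > 0" using assms by (simp add: mass_frac_def)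
qed

text \<open>For each species the ratio of heat capacity to gas constant is 3/2 or 5/2. Averaging the
  lower value gives the third claim, which is the bound \<gamma>(Y) \<le> 5/3 in another
  form.\<close>

lemma mixture_sums_pos:
  assumes "valid_mixture M" "\<And>\<alpha>. Y $ \<alpha> > 0"
  shows "r_mix M Y > 0" "Cv_mix M Y > 0" "3 * r_mix M Y \<le> 2 * Cv_mix M Y"
proof -
  have r: "gas_const M \<alpha> > 0" for \<alpha> using assms(1) by (simp add: valid_mixture_def)
  show "r_mix M Y > 0" unfolding r_mix_def using assms r by (intro sum_pos) auto
  show le: "3 * r_mix M Y \<le> 2 * Cv_mix M Y"
    unfolding r_mix_def Cv_mix_def sum_distrib_left Cv_species_def
    using r assms(2) by (intro sum_mono) (auto simp: less_imp_le)
  show "Cv_mix M Y > 0" using le \<open>r_mix M Y > 0\<close> by linarith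
qed

lemma gamma_mix_bounds:
  assumes "valid_mixture M" "\<And>\<alpha>. Y $ \<alpha> > 0"
  shows "gamma_mix M Y > 1" "gamma_mix M Y \<le> 5/3"
  using mixture_sums_pos[OF assms] by (auto simp: gamma_mix_def divide_simps)

section \<open>The translation-rotation energy in conserved variables\<close>

lemma e_trans_eq:
  assumes "\<And>\<alpha>. R $ \<alpha> > 0"
  shows "e_trans M (R, m, En, V) = (En - (\<Sum>\<alpha>\<in>UNIV. form_enthalpy M \<alpha> * R $ \<alpha>)
    - (\<Sum>\<beta>\<in>UNIV. V $ \<beta>)) / total_density R - kinetic_energy R m"
proof -
  have "(\<Sum>\<alpha>\<in>UNIV. mass_frac R $ \<alpha> * form_enthalpy M \<alpha>)
      = (\<Sum>\<alpha>\<in>UNIV. form_enthalpy M \<alpha> * R $ \<alpha>) / total_density R"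
    by (simp add: mass_frac_def sum_divide_distrib mult.commute)
  moreover have "(\<Sum>\<beta>\<in>UNIV. mass_frac R $ vib_species M \<beta> * vib_energies M R V $ \<beta>)
      = (\<Sum>\<beta>\<in>UNIV. V $ \<beta>) / total_density R"
    using assms by (simp add: mass_frac_def vib_energies_def sum_divide_distrib less_imp_neq[symmetric])
  ultimately show ?thesis by (simp add: diff_divide_distrib)
qed

lemma density_e_trans:
  assumes "\<And>\<alpha>. R $ \<alpha> > 0"
  shows "total_density R * e_trans M (R, m, En, V) = En - (\<Sum>\<alpha>\<in>UNIV. form_enthalpy M \<alpha> * R $ \<alpha>)
    - (\<Sum>\<beta>\<in>UNIV. V $ \<beta>) - total_density R * kinetic_energy R m"
proof -
  have "total_density R * (X / total_density R - k) = X - total_density R * k" for X k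
    using mass_frac_pos(1)[OF assms] by (simp add: right_diff_distrib)
  then show ?thesis by (simp only: e_trans_eq[OF assms])
qed

text \<open>The formation and vibration energies that \<open>L_op\<close> adds are exactly those
  that \<open>e_trans\<close> subtracts, so only the two relaxation energies remain.\<close>

lemma e_trans_L_op:
  assumes "\<And>\<alpha>. R $ \<alpha> > 0"
  shows "e_trans M (L_op M (R, m, En, V, S)) = e_relax (R, m, En, V, S) + S / total_density R"
  using assms by (simp add: e_trans_eq add_divide_distrib del: e_trans.simps)

text \<open>Fraction of the translation-rotation energy that \<open>P_op\<close> puts into \<open>e\<^sub>r\<close>.\<close>

definition relax_fraction :: "('s::finite, 'b::finite) mixture \<Rightarrow> real \<Rightarrow> real^'s \<Rightarrow> real" where
  "relax_fraction M \<gamma> R = (gamma_mix M (mass_frac R) - 1) / (\<gamma> - 1)"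

text \<open>From 1 < \<gamma>(Y) \<le> 5/3 < \<gamma>. Strictness on both sides makes both energies
  of \<open>P_op\<close> positive and allows logarithms of \<theta> and 1 - \<theta>.\<close>

lemma relax_fraction_bounds:
  assumes "valid_mixture M" "\<gamma> > 5/3" "\<And>\<alpha>. R $ \<alpha> > 0"
  shows "0 < relax_fraction M \<gamma> R" "relax_fraction M \<gamma> R < 1"
  using gamma_mix_bounds[OF assms(1) mass_frac_pos(2)[OF assms(3)]] assms(2)
  by (auto simp: relax_fraction_def divide_simps)

text \<open>The total density cancels in r/C_v. What is left is, up to a constant, a quotient of
  linear functions of the partial densities, as the Lipschitz estimate requires.\<close>

lemma relax_fraction_eq:
  assumes "\<And>\<alpha>. R $ \<alpha> > 0"
  shows "relax_fraction M \<gamma> R = r_mix M R * inverse (Cv_mix M R) / (\<gamma> - 1)"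
  using mass_frac_pos(1)[OF assms]
  by (simp add: relax_fraction_def gamma_mix_def mixture_sums_mass_frac divide_inverse)

lemma P_op_eq:
  assumes "\<And>\<alpha>. R $ \<alpha> > 0"
  shows "P_op M \<gamma> (R, m, En, V) =
    (let \<rho> = total_density R; \<theta> = relax_fraction M \<gamma> R; e = e_trans M (R, m, En, V)
     in (R, m, \<rho> * (\<theta> * e + kinetic_energy R m), V, \<rho> * ((1 - \<theta>) * e)))"
proof -
  have "pressure M (R, m, En, V) / ((\<gamma> - 1) * total_density R)
      = relax_fraction M \<gamma> R * e_trans M (R, m, En, V)"
    using mass_frac_pos(1)[OF assms] by (simp add: relax_fraction_def del: e_trans.simps)
  then show ?thesis
    by (simp only: P_op.simps Let_def) (simp add: algebra_simps del: e_trans.simps pressure.simps)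
qed

section \<open>How the two maps act on states and fluxes\<close>

lemma fst_P_op [simp]: "fst (P_op M \<gamma> u) = fst u"
  and momentum_P_op [simp]: "fst (snd (P_op M \<gamma> u)) = fst (snd u)"
  by (cases u; simp add: Let_def del: e_trans.simps)+

lemma fst_L_op [simp]: "fst (L_op M w) = fst w"
  by (cases w) simp

lemma Omega_a_density_pos: "u \<in> Omega_a M \<Longrightarrow> fst u $ \<alpha> > 0"
  by (auto simp: Omega_a_def)

lemma P_op_energies:
  assumes "\<And>\<alpha>. R $ \<alpha> > 0" "P_op M \<gamma> (R, m, En, V) = (R', m', En', V', S')"
  shows "e_relax (R', m', En', V', S') = relax_fraction M \<gamma> R * e_trans M (R, m, En, V)"
    and "S' / total_density R' = (1 - relax_fraction M \<gamma> R) * e_trans M (R, m, En, V)"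
  using assms(2) mass_frac_pos(1)[OF assms(1)]
  by (auto simp: P_op_eq[OF assms(1)] Let_def simp del: e_trans.simps P_op.simps)

text \<open>\<open>P_op\<close> splits \<rho> e_t into the shares \<theta> and 1 - \<theta>.
  \<open>L_op\<close> adds them up again and restores the formation and vibration energies.\<close>

lemma L_op_P_op:
  assumes "u \<in> Omega_a M"
  shows "L_op M (P_op M \<gamma> u) = u"
proof -
  obtain R m En V where u: "u = (R, m, En, V)" by (cases u)
  have R: "\<And>\<alpha>. R $ \<alpha> > 0" using assms by (simp add: u Omega_a_def)
  note \<rho> = mass_frac_pos(1)[OF R]
  have "total_density R * e_trans M u + total_density R * kinetic_energy R m
      = En - (\<Sum>\<alpha>\<in>UNIV. form_enthalpy M \<alpha> * R $ \<alpha>) - (\<Sum>\<beta>\<in>UNIV. V $ \<beta>)"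
    using \<rho> by (simp add: u density_e_trans[OF R] del: e_trans.simps)
  then show ?thesis
    by (simp add: u P_op_eq[OF R] Let_def algebra_simps del: e_trans.simps P_op.simps)
qed

lemma P_op_in_Omega_r:
  assumes "valid_mixture M" "\<gamma> > 5/3" "u \<in> Omega_a M"
  shows "P_op M \<gamma> u \<in> Omega_r M"
proof -
  obtain R m En V where u: "u = (R, m, En, V)" by (cases u)
  have R: "\<And>\<alpha>. R $ \<alpha> > 0" using assms by (simp add: u Omega_a_def)
  obtain En' S' where P: "P_op M \<gamma> u = (R, m, En', V, S')"
    by (simp add: u Let_def del: e_trans.simps)
  have "e_trans M u > 0" "\<And>\<beta>. vib_energies M R V $ \<beta> > 0"
    using assms(3) by (auto simp: u Omega_a_def)
  then show ?thesis
    using relax_fraction_bounds[OF assms(1,2) R] P_op_energies[OF R P[unfolded u]]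
    unfolding P by (simp add: Omega_r_def R u del: e_trans.simps e_relax.simps)
qed

lemma L_op_in_Omega_a:
  assumes "w \<in> Omega_r M"
  shows "L_op M w \<in> Omega_a M"
proof -
  obtain R m En V S where w: "w = (R, m, En, V, S)" by (cases w)
  have *: "\<And>\<alpha>. R $ \<alpha> > 0" "e_relax w > 0" "S / total_density R > 0"
      "\<And>\<beta>. vib_energies M R V $ \<beta> > 0"
    using assms by (auto simp: w Omega_r_def)
  have "e_trans M (L_op M w) > 0"
    using * e_trans_L_op[OF *(1), of M m En V S] by (simp add: w del: e_trans.simps e_relax.simps L_op.simps)
  with * show ?thesis by (simp add: w Omega_a_def del: e_trans.simps)
qed

text \<open>The value of e_r chosen by \<open>P_op\<close> makes the relaxation pressure equal to
  the Euler pressure. Every term that \<open>L_op\<close> adds to the energy flux is transported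
  with the same normal velocity, so together they complete the relaxation energy to the Euler
  energy.\<close>

lemma L_op_relax_flux_P_op:
  assumes "valid_mixture M" "\<gamma> > 5/3" "u \<in> Omega_a M"
  shows "L_op M (relax_flux \<gamma> (P_op M \<gamma> u) n) = euler_flux M u n"
proof -
  obtain R m En V where u: "u = (R, m, En, V)" by (cases u)
  have R: "\<And>\<alpha>. R $ \<alpha> > 0" using assms by (simp add: u Omega_a_def)
  obtain En' S' where P: "P_op M \<gamma> u = (R, m, En', V, S')"
    by (simp add: u Let_def del: e_trans.simps)
  have p: "(\<gamma> - 1) * total_density R * e_relax (R, m, En', V, S') = pressure M u"
    using P_op_energies(1)[OF R P[unfolded u]] assms(2)
    by (simp add: u relax_fraction_def del: e_trans.simps e_relax.simps)
  have En: "En = En' + S' + (\<Sum>\<alpha>\<in>UNIV. form_enthalpy M \<alpha> * R $ \<alpha>) + (\<Sum>\<beta>\<in>UNIV. V $ \<beta>)"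
    using L_op_P_op[OF assms(3), of \<gamma>] unfolding P by (simp add: u)
  define k where "k = velocity R m \<bullet> n"
  have "L_op M (relax_flux \<gamma> (R, m, En', V, S') n) =
     (k *\<^sub>R R, (total_density R * k) *\<^sub>R velocity R m + pressure M u *\<^sub>R n,
      (En' + pressure M u) * k + S' * k + (\<Sum>\<alpha>\<in>UNIV. form_enthalpy M \<alpha> * (k * R $ \<alpha>))
        + (\<Sum>\<beta>\<in>UNIV. k * V $ \<beta>), k *\<^sub>R V)"
    by (simp only: relax_flux.simps Let_def p) (simp add: k_def)
  also have "\<dots> = (k *\<^sub>R R, (total_density R * k) *\<^sub>R velocity R m + pressure M u *\<^sub>R n,
      (En + pressure M u) * k, k *\<^sub>R V)"
    unfolding En by (simp add: sum_distrib_left algebra_simps)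
  also have "\<dots> = euler_flux M u n"
    by (simp add: u k_def Let_def del: pressure.simps)
  finally show ?thesis by (simp only: P)
qed

text \<open>In conserved variables each component arises from linear functions through sums,
  products and reciprocals of the total density and of C_v, both positive on
  \<open>Omega_a\<close>.\<close>

lemma locally_lipschitz_on_P_op:
  assumes M: "valid_mixture M"
  shows "locally_lipschitz_on (Omega_a M) (P_op M \<gamma> :: ('s::finite, 'd::finite, 'b::finite) euler_state \<Rightarrow> _)"
proof -
  let ?X = "Omega_a M :: ('s, 'd, 'b) euler_state set"
  have pos: "total_density (fst u) > 0" "Cv_mix M (fst u) > 0" if "u \<in> ?X" for u
    using mass_frac_pos(1)[OF Omega_a_density_pos[OF that]]
      mixture_sums_pos(2)[OF M Omega_a_density_pos[OF that]] by auto
  define \<theta> where "\<theta> = (\<lambda>u::('s, 'd, 'b) euler_state.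
    r_mix M (fst u) * inverse (Cv_mix M (fst u)) * inverse (\<gamma> - 1))"
  \<comment> \<open>\<open>ec\<close> and \<open>et\<close> are energies per unit volume. Writing
    the kinetic part as |m|^2/(2\<rho>) leaves a single reciprocal.\<close>
  define ec where "ec = (\<lambda>u::('s, 'd, 'b) euler_state.
    (fst (snd u) \<bullet> fst (snd u)) * (inverse (total_density (fst u)) * (1/2)))"
  define et where "et = (\<lambda>u::('s, 'd, 'b) euler_state. fst (snd (snd u))
    - (\<Sum>\<alpha>\<in>UNIV. form_enthalpy M \<alpha> * fst u $ \<alpha>) - (\<Sum>\<beta>\<in>UNIV. snd (snd (snd u)) $ \<beta>) - ec u)"
  have lin: "linear (fst :: ('s, 'd, 'b) euler_state \<Rightarrow> _)"
     "linear (\<lambda>u::('s, 'd, 'b) euler_state. fst (snd u))"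
     "linear (\<lambda>u::('s, 'd, 'b) euler_state. snd (snd (snd u)))"
     "linear (\<lambda>u::('s, 'd, 'b) euler_state. total_density (fst u))"
     "linear (\<lambda>u::('s, 'd, 'b) euler_state. r_mix M (fst u))"
     "linear (\<lambda>u::('s, 'd, 'b) euler_state. Cv_mix M (fst u))"
     "linear (\<lambda>u::('s, 'd, 'b) euler_state. fst (snd (snd u))
        - (\<Sum>\<alpha>\<in>UNIV. form_enthalpy M \<alpha> * fst u $ \<alpha>) - (\<Sum>\<beta>\<in>UNIV. snd (snd (snd u)) $ \<beta>))"
    by (auto intro!: linearI simp: total_density_def r_mix_def Cv_mix_def sum.distrib
        sum_distrib_left algebra_simps)
  note ll = lin[THEN locally_lipschitz_on_linear]
  have ll\<theta>: "locally_lipschitz_on ?X \<theta>" unfolding \<theta>_def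
    by (intro locally_lipschitz_on_mult locally_lipschitz_on_inverse locally_lipschitz_on_const ll pos)
  have llec: "locally_lipschitz_on ?X ec" unfolding ec_def
    by (intro locally_lipschitz_on_mult locally_lipschitz_on_inner locally_lipschitz_on_inverse
        locally_lipschitz_on_const ll pos)
  have llet: "locally_lipschitz_on ?X et" unfolding et_def
    by (rule locally_lipschitz_on_diff[OF ll(7) llec])
  have "locally_lipschitz_on ?X (\<lambda>u. (fst u, fst (snd u), \<theta> u * et u + ec u, snd (snd (snd u)),
      (1 - \<theta> u) * et u))"
    by (intro locally_lipschitz_on_Pair locally_lipschitz_on_add locally_lipschitz_on_mult
        locally_lipschitz_on_diff locally_lipschitz_on_const ll ll\<theta> llec llet)
  then show ?thesis
  proof (rule locally_lipschitz_on_cong)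
    fix u :: "('s, 'd, 'b) euler_state" assume "u \<in> ?X"
    moreover obtain R m En V where u: "u = (R, m, En, V)" by (cases u)
    ultimately have R: "\<And>\<alpha>. R $ \<alpha> > 0" by (simp add: Omega_a_def)
    note \<rho> = mass_frac_pos(1)[OF R]
    have th: "\<theta> u = relax_fraction M \<gamma> R"
      by (simp add: \<theta>_def u relax_fraction_eq[OF R] divide_inverse)
    have ec: "ec u = total_density R * kinetic_energy R m"
      using \<rho> by (simp add: ec_def u kinetic_energy_def velocity_def power_mult_distrib
          dot_square_norm power2_eq_square divide_simps)
    have et: "et u = total_density R * e_trans M u"
      using \<rho> by (simp add: et_def ec[unfolded u] u density_e_trans[OF R] del: e_trans.simps)
    show "(fst u, fst (snd u), \<theta> u * et u + ec u, snd (snd (snd u)), (1 - \<theta> u) * et u) = P_op M \<gamma> u"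
      unfolding th ec et
      by (simp add: u P_op_eq[OF R] Let_def algebra_simps del: P_op.simps e_trans.simps)
  qed
qed

section \<open>Comparison of the entropies\<close>

text \<open>Both entropies have the same mass fractions and vibration energies, so
  \<open>K_mix\<close> and the vibration terms cancel. Since r = \<theta> (\<gamma> - 1) C_v, the
  exponent 1/(\<gamma> - 1) in \<T> turns into the weight \<theta>.\<close>

lemma entropy_gap:
  assumes M: "valid_mixture M" and \<gamma>: "\<gamma> > 5/3" and "(R, m, En, V, S) \<in> Omega_r M"
  defines "\<theta> \<equiv> relax_fraction M \<gamma> R" and "e\<^sub>r \<equiv> e_relax (R, m, En, V, S)" and "e\<^sub>s \<equiv> S / total_density R"
  shows "- relax_entropy M \<gamma> (R, m, En, V, S) - spec_entropy M (L_op M (R, m, En, V, S))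
    = Cv_mix M (mass_frac R) *
      ((1 - \<theta>) * ln (e\<^sub>s / ((1 - \<theta>) * (e\<^sub>r + e\<^sub>s))) + \<theta> * ln (e\<^sub>r / (\<theta> * (e\<^sub>r + e\<^sub>s))))"
proof -
  have R: "\<And>\<alpha>. R $ \<alpha> > 0" and e: "e\<^sub>r > 0" "e\<^sub>s > 0"
    using assms(3) by (auto simp: Omega_r_def e\<^sub>r_def e\<^sub>s_def)
  define Y where "Y = mass_frac R"
  define g where "g = gamma_mix M Y"
  define \<tau> where "\<tau> = 1 / total_density R"
  define C where "C = Cv_mix M Y"
  have \<tau>: "\<tau> > 0" using mass_frac_pos(1)[OF R] by (simp add: \<tau>_def)
  have Ypos: "\<And>\<alpha>. Y $ \<alpha> > 0" unfolding Y_def by (rule mass_frac_pos(2)[OF R])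
  have g: "1 < g" "g < \<gamma>" using gamma_mix_bounds[OF M Ypos] \<gamma> by (auto simp: g_def)
  have C: "C > 0" "r_mix M Y = (g - 1) * C"
    using mixture_sums_pos[OF M Ypos] by (auto simp: C_def g_def gamma_mix_def)
  have \<theta>: "0 < \<theta>" "\<theta> < 1" unfolding \<theta>_def using relax_fraction_bounds[OF M \<gamma> R] by auto
  have th: "g - 1 = \<theta> * (\<gamma> - 1)" "\<gamma> - g = (1 - \<theta>) * (\<gamma> - 1)"
    using \<gamma> by (auto simp: \<theta>_def relax_fraction_def g_def Y_def field_simps)
  define T where "T = ((\<gamma> - g) / (g - 1)
    * ((- (- ((\<tau> powr (\<gamma> - 1) * e\<^sub>r) powr (1 / \<gamma>)))) powr \<gamma> / e\<^sub>s)) powr (1 / (\<gamma> - 1))"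
  define E where "E = (g - 1) / (\<gamma> - g) * e\<^sub>s + e\<^sub>s"
  \<comment> \<open>\<open>E\<close> is the total internal energy of which \<open>e\<^sub>s\<close>
    is the equilibrium share 1 - \<theta>.\<close>
  have E: "E = e\<^sub>s / (1 - \<theta>)"
  proof -
    have "(g - 1) / (\<gamma> - g) = \<theta> / (1 - \<theta>)" using \<gamma> by (simp add: th)
    then have "E = \<theta> / (1 - \<theta>) * e\<^sub>s + e\<^sub>s" by (simp only: E_def)
    then show ?thesis using \<theta> by (simp add: field_simps)
  qed
  \<comment> \<open>The powers 1/\<gamma> and \<gamma> cancel, which replaces the power of -s_r by
    \<tau>^(\<gamma>-1) e_r.\<close>
  have T: "T = ((1 - \<theta>) / \<theta> * (\<tau> powr (\<gamma> - 1) * e\<^sub>r / e\<^sub>s)) powr (1 / (\<gamma> - 1))"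
    using \<theta> \<gamma> e \<tau> by (simp add: T_def th powr_powr)
  have lnT: "(g - 1) * ln T = (g - 1) * ln \<tau> + \<theta> * (ln (1 - \<theta>) - ln \<theta> + ln e\<^sub>r - ln e\<^sub>s)"
  proof -
    have "ln T = 1 / (\<gamma> - 1) * (ln (1 - \<theta>) - ln \<theta> + ((\<gamma> - 1) * ln \<tau> + ln e\<^sub>r - ln e\<^sub>s))"
      using \<theta> e \<tau> unfolding T by (simp add: ln_powr ln_mult ln_div)
    then have "(g - 1) * ln T = \<theta> * (ln (1 - \<theta>) - ln \<theta> + ((\<gamma> - 1) * ln \<tau> + ln e\<^sub>r - ln e\<^sub>s))"
      using \<gamma> by (simp add: th(1))
    also have "\<dots> = \<theta> * (\<gamma> - 1) * ln \<tau> + \<theta> * (ln (1 - \<theta>) - ln \<theta> + ln e\<^sub>r - ln e\<^sub>s)"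
      by (simp add: algebra_simps)
    finally show ?thesis by (simp only: th(1))
  qed
  have sL: "spec_entropy M (L_op M (R, m, En, V, S)) = mixture_entropy M Y \<tau> (e\<^sub>r + e\<^sub>s) (vib_energies M R V)"
    using e_trans_L_op[OF R, of M m En V S]
    by (simp add: Y_def \<tau>_def e\<^sub>r_def e\<^sub>s_def del: e_trans.simps e_relax.simps)
  have z: "relax_entropy M \<gamma> (R, m, En, V, S) = - mixture_entropy M Y T E (vib_energies M R V)"
    by (simp only: relax_entropy.simps Let_def T_def E_def Y_def g_def \<tau>_def e\<^sub>r_def e\<^sub>s_def)
  have "- relax_entropy M \<gamma> (R, m, En, V, S) - spec_entropy M (L_op M (R, m, En, V, S))
      = C * (ln E - ln (e\<^sub>r + e\<^sub>s)) + C * ((g - 1) * ln T - (g - 1) * ln \<tau>)"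
    unfolding sL z by (simp add: mixture_entropy_def C(2) C_def[symmetric] algebra_simps)
  also have "\<dots> = C * ((1 - \<theta>) * ln (e\<^sub>s / ((1 - \<theta>) * (e\<^sub>r + e\<^sub>s))) + \<theta> * ln (e\<^sub>r / (\<theta> * (e\<^sub>r + e\<^sub>s))))"
  proof -
    define F where "F = e\<^sub>r + e\<^sub>s"
    have F: "F > 0" using e by (simp add: F_def)
    have lns: "ln E = ln e\<^sub>s - ln (1 - \<theta>)"
      "ln (e\<^sub>s / ((1 - \<theta>) * F)) = ln e\<^sub>s - (ln (1 - \<theta>) + ln F)"
      "ln (e\<^sub>r / (\<theta> * F)) = ln e\<^sub>r - (ln \<theta> + ln F)"
      using \<theta> e F by (simp_all add: E ln_mult ln_div)
    then show ?thesis
      unfolding lnT F_def[symmetric] lns by (simp add: algebra_simps)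
  qed
  finally show ?thesis by (simp only: C_def Y_def)
qed

text \<open>With e = e_r + e_s, the bracket in \<open>entropy_gap\<close> is minus the relative
  entropy (Kullback-Leibler divergence) of the weights (1 - \<theta>, \<theta>) with respect to the
  energy shares (e_s/e, e_r/e), hence nonpositive.\<close>

lemma spec_entropy_L_op_ge:
  assumes M: "valid_mixture M" and \<gamma>: "\<gamma> > 5/3" and w: "w \<in> Omega_r M"
  shows "- relax_entropy M \<gamma> w \<le> spec_entropy M (L_op M w)"
proof -
  obtain R m En V S where W: "w = (R, m, En, V, S)" by (cases w)
  define e\<^sub>r where "e\<^sub>r = e_relax (R, m, En, V, S)"
  define e\<^sub>s where "e\<^sub>s = S / total_density R"
  define \<theta> where "\<theta> = relax_fraction M \<gamma> R"
  have R: "\<And>\<alpha>. R $ \<alpha> > 0" and e: "e\<^sub>r > 0" "e\<^sub>s > 0"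
    using w by (auto simp: W Omega_r_def e\<^sub>r_def e\<^sub>s_def)
  have \<theta>: "0 < \<theta>" "\<theta> < 1" unfolding \<theta>_def using relax_fraction_bounds[OF M \<gamma> R] by auto
  have C: "Cv_mix M (mass_frac R) > 0" by (intro mixture_sums_pos[OF M] mass_frac_pos R)
  \<comment> \<open>After ln x \<le> x - 1 in both terms the right-hand side vanishes, because the
    weights and the shares each sum to 1.\<close>
  have "(1 - \<theta>) * ln (e\<^sub>s / ((1 - \<theta>) * (e\<^sub>r + e\<^sub>s))) + \<theta> * ln (e\<^sub>r / (\<theta> * (e\<^sub>r + e\<^sub>s)))
      \<le> (1 - \<theta>) * (e\<^sub>s / ((1 - \<theta>) * (e\<^sub>r + e\<^sub>s)) - 1) + \<theta> * (e\<^sub>r / (\<theta> * (e\<^sub>r + e\<^sub>s)) - 1)"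
    using \<theta> e by (intro add_mono mult_left_mono ln_le_minus_one) auto
  also have "\<dots> = (e\<^sub>s / (e\<^sub>r + e\<^sub>s) - (1 - \<theta>)) + (e\<^sub>r / (e\<^sub>r + e\<^sub>s) - \<theta>)"
    using \<theta> by (simp add: right_diff_distrib)
  also have "\<dots> = (e\<^sub>s + e\<^sub>r) / (e\<^sub>r + e\<^sub>s) - 1" by (simp add: add_divide_distrib)
  also have "\<dots> = 0" using e by simp
  finally have "(1 - \<theta>) * ln (e\<^sub>s / ((1 - \<theta>) * (e\<^sub>r + e\<^sub>s))) + \<theta> * ln (e\<^sub>r / (\<theta> * (e\<^sub>r + e\<^sub>s))) \<le> 0" .
  then have "- relax_entropy M \<gamma> w - spec_entropy M (L_op M w) \<le> 0"
    using entropy_gap[OF M \<gamma> w[unfolded W]] C unfolding W e\<^sub>r_def e\<^sub>s_def \<theta>_def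
    by (simp only: mult_nonneg_nonpos less_imp_le)
  then show ?thesis by simp
qed

text \<open>This is the equality case: the energy shares of \<open>P_op\<close> are exactly \<theta>
  and 1 - \<theta>, so both logarithms in the gap are ln 1.\<close>

lemma relax_entropy_P_op:
  assumes M: "valid_mixture M" and \<gamma>: "\<gamma> > 5/3" and a: "u \<in> Omega_a M"
  shows "relax_entropy M \<gamma> (P_op M \<gamma> u) = - spec_entropy M u"
proof -
  obtain R m En V where u: "u = (R, m, En, V)" by (cases u)
  have R: "\<And>\<alpha>. R $ \<alpha> > 0" and e: "e_trans M u > 0" using a by (auto simp: u Omega_a_def)
  obtain En' S' where P: "P_op M \<gamma> u = (R, m, En', V, S')"
    by (simp add: u Let_def del: e_trans.simps)
  note \<theta> = relax_fraction_bounds[OF M \<gamma> R]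
  note en = P_op_energies[OF R P[unfolded u], folded u]
  have s: "relax_fraction M \<gamma> R * e_trans M u + (1 - relax_fraction M \<gamma> R) * e_trans M u = e_trans M u"
    by (simp add: algebra_simps)
  have "- relax_entropy M \<gamma> (P_op M \<gamma> u) - spec_entropy M (L_op M (P_op M \<gamma> u)) = 0"
    using entropy_gap[OF M \<gamma> P_op_in_Omega_r[OF M \<gamma> a, unfolded P]] \<theta> e
    unfolding P en s by simp
  then show ?thesis by (simp add: L_op_P_op[OF a])
qed

lemma eta_L_op_le:
  assumes M: "valid_mixture M" and \<gamma>: "\<gamma> > 5/3" and w: "w \<in> Omega_r M"
  shows "eta M (L_op M w) \<le> total_density (fst w) * relax_entropy M \<gamma> w"
proof -
  have "total_density (fst w) > 0"
    by (rule mass_frac_pos) (use w in \<open>auto simp: Omega_r_def\<close>)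
  then have "total_density (fst w) * (- spec_entropy M (L_op M w)) \<le> total_density (fst w) * relax_entropy M \<gamma> w"
    using spec_entropy_L_op_ge[OF assms] by (intro mult_left_mono) auto
  then show ?thesis by (simp add: eta_def)
qed

section \<open>The induced scheme\<close>

lemma lipschitz_induced_flux:
  assumes M: "valid_mixture M" and \<gamma>: "\<gamma> > 5/3" and H: "lipschitz_flux (Omega_r M) H n"
  shows "lipschitz_flux (Omega_a M) (induced_flux M \<gamma> H) n"
proof -
  let ?X = "Omega_a M \<times> Omega_a M"
  have P: "locally_lipschitz_on ?X (\<lambda>p. P_op M \<gamma> (fst p))" "locally_lipschitz_on ?X (\<lambda>p. P_op M \<gamma> (snd p))"
    by (rule locally_lipschitz_on_compose[OF locally_lipschitz_on_P_op[OF M]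
          locally_lipschitz_on_bounded_linear[OF bounded_linear_fst]], force)
       (rule locally_lipschitz_on_compose[OF locally_lipschitz_on_P_op[OF M]
          locally_lipschitz_on_bounded_linear[OF bounded_linear_snd]], force)
  have "locally_lipschitz_on ?X (\<lambda>p. (\<lambda>(a, b). H a b n) (P_op M \<gamma> (fst p), P_op M \<gamma> (snd p)))"
    by (rule locally_lipschitz_on_compose[OF H[unfolded lipschitz_flux_def]
          locally_lipschitz_on_Pair[OF P]])
       (auto intro: P_op_in_Omega_r[OF M \<gamma>] simp del: P_op.simps)
  then have "locally_lipschitz_on ?X
      (\<lambda>p. L_op M ((\<lambda>(a, b). H a b n) (P_op M \<gamma> (fst p), P_op M \<gamma> (snd p))))"
    by (rule locally_lipschitz_on_compose[OF locally_lipschitz_on_linear[OF linear_L_op, of UNIV]]) simp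
  then show ?thesis
    by (simp add: lipschitz_flux_def induced_flux_def case_prod_unfold del: P_op.simps L_op.simps)
qed

text \<open>Linearity takes \<open>L_op\<close> through the update formula, and it undoes
  \<open>P_op\<close> on the initial data.\<close>

lemma L_op_scheme_step:
  assumes "scheme_step \<Delta>x \<Delta>t (induced_flux M \<gamma> H) n U U'" "\<forall>j. U j \<in> Omega_a M"
    and "scheme_step \<Delta>x \<Delta>t H n (\<lambda>j. P_op M \<gamma> (U j)) W'"
  shows "L_op M (W' j) = U' j"
proof -
  let ?W = "\<lambda>j. P_op M \<gamma> (U j)"
  have W': "W' j = ?W j - (\<Delta>t / \<Delta>x) *\<^sub>R (H (?W j) (?W (j + 1)) n - H (?W (j - 1)) (?W j) n)"
    using assms(3)[unfolded scheme_step_def, rule_format, of j] by (simp add: algebra_simps)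
  have "U' j = U j - (\<Delta>t / \<Delta>x) *\<^sub>R
      (induced_flux M \<gamma> H (U j) (U (j + 1)) n - induced_flux M \<gamma> H (U (j - 1)) (U j) n)"
    using assms(1)[unfolded scheme_step_def, rule_format, of j] by (simp add: algebra_simps)
  then show ?thesis
    using assms(2) unfolding W' induced_flux_def
    by (simp add: linear_diff[OF linear_L_op] linear_scale[OF linear_L_op] L_op_P_op
        del: P_op.simps L_op.simps)
qed

text \<open>The time step condition enters as an arbitrary predicate \<open>step_cond\<close> on the
  step and the data, evaluated for the Euler scheme at the image under \<open>P_op\<close>. The
  hypothesis on the relaxation scheme concerns one step of an arbitrary sequence, so it applies to a
  step restarted from equilibrium data.\<close>

theorem theorem4p3:
  fixes M :: "('s::finite, 'b::finite) mixture"
    and \<gamma> \<Delta>x :: real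
    and n :: "real^'d::finite"
    and H :: "('s, 'd, 'b) relax_state \<Rightarrow> ('s, 'd, 'b) relax_state \<Rightarrow> real^'d \<Rightarrow> ('s, 'd, 'b) relax_state"
    and Z :: "('s, 'd, 'b) relax_state \<Rightarrow> ('s, 'd, 'b) relax_state \<Rightarrow> real^'d \<Rightarrow> real"
    and step_cond :: "real \<Rightarrow> (int \<Rightarrow> ('s, 'd, 'b) relax_state) \<Rightarrow> bool"
  assumes mixture: "valid_mixture M"
    and gamma: "\<gamma> > 5/3"
    and unit: "norm n = 1"
    and dx: "\<Delta>x > 0"
    and H_lipschitz: "lipschitz_flux (Omega_r M) H n"
    and H_consistent: "consistent_flux (Omega_r M) (relax_flux \<gamma>) H n"
    and H_conservative: "conservative_flux (Omega_r M) H n"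
    and Z_consistent: "consistent_flux (Omega_r M)
          (\<lambda>w n. total_density (fst w) * relax_entropy M \<gamma> w * (velocity (fst w) (fst (snd w)) \<bullet> n)) Z n"
    and relax_scheme:
      "\<forall>(W :: nat \<Rightarrow> int \<Rightarrow> ('s, 'd, 'b) relax_state) (\<Delta>t :: nat \<Rightarrow> real) k.
         \<Delta>t k > 0 \<and> (\<forall>j. W k j \<in> Omega_r M) \<and> step_cond (\<Delta>t k) (W k)
         \<and> scheme_step \<Delta>x (\<Delta>t k) H n (W k) (W (Suc k)) \<longrightarrow>
           (\<forall>j. total_density (fst (W (Suc k) j)) * relax_entropy M \<gamma> (W (Suc k) j)
                 \<le> total_density (fst (W k j)) * relax_entropy M \<gamma> (W k j)
                   - \<Delta>t k / \<Delta>x * (Z (W k j) (W k (j + 1)) n - Z (W k (j - 1)) (W k j) n))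
         \<and> (\<forall>j \<alpha>.
              min (mass_frac (fst (W k (j - 1))) $ \<alpha>)
                (min (mass_frac (fst (W k j)) $ \<alpha>) (mass_frac (fst (W k (j + 1))) $ \<alpha>))
                \<le> mass_frac (fst (W (Suc k) j)) $ \<alpha>
            \<and> mass_frac (fst (W (Suc k) j)) $ \<alpha>
                \<le> max (mass_frac (fst (W k (j - 1))) $ \<alpha>)
                    (max (mass_frac (fst (W k j)) $ \<alpha>) (mass_frac (fst (W k (j + 1))) $ \<alpha>)))
         \<and> (\<forall>j. relax_entropy M \<gamma> (W (Suc k) j)
                 \<le> max (relax_entropy M \<gamma> (W k (j - 1)))
                     (max (relax_entropy M \<gamma> (W k j)) (relax_entropy M \<gamma> (W k (j + 1)))))
         \<and> (\<forall>j. W (Suc k) j \<in> Omega_r M)"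
  shows "lipschitz_flux (Omega_a M) (induced_flux M \<gamma> H) n
         \<and> consistent_flux (Omega_a M) (euler_flux M) (induced_flux M \<gamma> H) n
         \<and> conservative_flux (Omega_a M) (induced_flux M \<gamma> H) n
         \<and> consistent_flux (Omega_a M) (\<lambda>u n. entropy_flux M u \<bullet> n) (induced_entropy_flux M \<gamma> Z) n
         \<and> (\<forall>(U :: nat \<Rightarrow> int \<Rightarrow> ('s, 'd, 'b) euler_state) (\<Delta>t :: nat \<Rightarrow> real) k.
           \<Delta>t k > 0 \<and> (\<forall>j. U k j \<in> Omega_a M) \<and> step_cond (\<Delta>t k) (\<lambda>j. P_op M \<gamma> (U k j))
           \<and> scheme_step \<Delta>x (\<Delta>t k) (induced_flux M \<gamma> H) n (U k) (U (Suc k)) \<longrightarrow>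
             (\<forall>j. eta M (U (Suc k) j) - eta M (U k j)
                   + \<Delta>t k / \<Delta>x * (induced_entropy_flux M \<gamma> Z (U k j) (U k (j + 1)) n
                                   - induced_entropy_flux M \<gamma> Z (U k (j - 1)) (U k j) n) \<le> 0)
           \<and> (\<forall>j \<alpha>.
                min (mass_frac (fst (U k (j - 1))) $ \<alpha>)
                  (min (mass_frac (fst (U k j)) $ \<alpha>) (mass_frac (fst (U k (j + 1))) $ \<alpha>))
                  \<le> mass_frac (fst (U (Suc k) j)) $ \<alpha>
              \<and> mass_frac (fst (U (Suc k) j)) $ \<alpha>
                  \<le> max (mass_frac (fst (U k (j - 1))) $ \<alpha>)
                      (max (mass_frac (fst (U k j)) $ \<alpha>) (mass_frac (fst (U k (j + 1))) $ \<alpha>)))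
           \<and> (\<forall>j. spec_entropy M (U (Suc k) j)
                   \<ge> min (spec_entropy M (U k (j - 1)))
                       (min (spec_entropy M (U k j)) (spec_entropy M (U k (j + 1)))))
           \<and> (\<forall>j. U (Suc k) j \<in> Omega_a M))"
proof -
  note P_in = P_op_in_Omega_r[OF mixture gamma]
  note \<zeta>P = relax_entropy_P_op[OF mixture gamma]
  have cons: "consistent_flux (Omega_a M) (euler_flux M) (induced_flux M \<gamma> H) n"
    using H_consistent P_in L_op_relax_flux_P_op[OF mixture gamma]
    unfolding consistent_flux_def induced_flux_def by metis
  have conserv: "conservative_flux (Omega_a M) (induced_flux M \<gamma> H) n"
    using H_conservative P_in linear_neg[OF linear_L_op]
    unfolding conservative_flux_def induced_flux_def by metis
  have Q: "consistent_flux (Omega_a M) (\<lambda>u n. entropy_flux M u \<bullet> n) (induced_entropy_flux M \<gamma> Z) n"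
    unfolding consistent_flux_def
  proof
    fix u :: "('s, 'd, 'b) euler_state" assume u: "u \<in> Omega_a M"
    show "induced_entropy_flux M \<gamma> Z u u n = entropy_flux M u \<bullet> n"
      using Z_consistent P_in[OF u] \<zeta>P[OF u]
      by (simp add: consistent_flux_def induced_entropy_flux_def entropy_flux_def)
  qed
  have scheme: "(\<forall>j. eta M (U (Suc k) j) - eta M (U k j)
                   + \<Delta>t k / \<Delta>x * (induced_entropy_flux M \<gamma> Z (U k j) (U k (j + 1)) n
                                   - induced_entropy_flux M \<gamma> Z (U k (j - 1)) (U k j) n) \<le> 0)
           \<and> (\<forall>j \<alpha>.
                min (mass_frac (fst (U k (j - 1))) $ \<alpha>)
                  (min (mass_frac (fst (U k j)) $ \<alpha>) (mass_frac (fst (U k (j + 1))) $ \<alpha>))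
                  \<le> mass_frac (fst (U (Suc k) j)) $ \<alpha>
              \<and> mass_frac (fst (U (Suc k) j)) $ \<alpha>
                  \<le> max (mass_frac (fst (U k (j - 1))) $ \<alpha>)
                      (max (mass_frac (fst (U k j)) $ \<alpha>) (mass_frac (fst (U k (j + 1))) $ \<alpha>)))
           \<and> (\<forall>j. spec_entropy M (U (Suc k) j)
                   \<ge> min (spec_entropy M (U k (j - 1)))
                       (min (spec_entropy M (U k j)) (spec_entropy M (U k (j + 1)))))
           \<and> (\<forall>j. U (Suc k) j \<in> Omega_a M)"
    if "\<Delta>t k > 0" and U: "\<forall>j. U k j \<in> Omega_a M" and "step_cond (\<Delta>t k) (\<lambda>j. P_op M \<gamma> (U k j))"
      and step: "scheme_step \<Delta>x (\<Delta>t k) (induced_flux M \<gamma> H) n (U k) (U (Suc k))"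
    for U :: "nat \<Rightarrow> int \<Rightarrow> ('s, 'd, 'b) euler_state" and \<Delta>t :: "nat \<Rightarrow> real" and k
  proof -
    define w where "w = (\<lambda>j. P_op M \<gamma> (U k j))"
    \<comment> \<open>One relaxation step from the equilibrium data, solved explicitly for the new
      values.\<close>
    define w' where "w' = (\<lambda>j. w j - (\<Delta>t k / \<Delta>x) *\<^sub>R (H (w j) (w (j + 1)) n - H (w (j - 1)) (w j) n))"
    have st: "scheme_step \<Delta>x (\<Delta>t k) H n w w'"
      by (simp add: scheme_step_def w'_def)
    \<comment> \<open>The hypothesis speaks of a whole sequence, but only levels k and k + 1 matter;
      all levels other than k are filled with \<open>w'\<close>.\<close>
    define W where "W = (\<lambda>i. if i = k then w else w')"
    have Wk: "W k = w" "W (Suc k) = w'" by (simp_all add: W_def)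
    have "\<forall>j. w j \<in> Omega_r M" using P_in U unfolding w_def by blast
    note * = relax_scheme[rule_format, of \<Delta>t k W, unfolded Wk, OF conjI, OF that(1) conjI, OF this conjI,
        OF that(3)[folded w_def] st]
    have r: "\<And>j. total_density (fst (w' j)) * relax_entropy M \<gamma> (w' j)
          \<le> total_density (fst (w j)) * relax_entropy M \<gamma> (w j)
            - \<Delta>t k / \<Delta>x * (Z (w j) (w (j + 1)) n - Z (w (j - 1)) (w j) n)"
      and y: "\<And>j \<alpha>. min (mass_frac (fst (w (j - 1))) $ \<alpha>)
                (min (mass_frac (fst (w j)) $ \<alpha>) (mass_frac (fst (w (j + 1))) $ \<alpha>))
                \<le> mass_frac (fst (w' j)) $ \<alpha>
            \<and> mass_frac (fst (w' j)) $ \<alpha>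
                \<le> max (mass_frac (fst (w (j - 1))) $ \<alpha>)
                    (max (mass_frac (fst (w j)) $ \<alpha>) (mass_frac (fst (w (j + 1))) $ \<alpha>))"
      and z: "\<And>j. relax_entropy M \<gamma> (w' j) \<le> max (relax_entropy M \<gamma> (w (j - 1)))
                     (max (relax_entropy M \<gamma> (w j)) (relax_entropy M \<gamma> (w (j + 1))))"
      and O: "\<And>j. w' j \<in> Omega_r M"
      by (rule *[THEN conjunct1, THEN spec] *[THEN conjunct2, THEN conjunct1, THEN spec, THEN spec]
        *[THEN conjunct2, THEN conjunct2, THEN conjunct1, THEN spec]
        *[THEN conjunct2, THEN conjunct2, THEN conjunct2, THEN spec])+
    have U': "U (Suc k) j = L_op M (w' j)" for j
      using L_op_scheme_step[OF step U st[unfolded w_def]] by (simp add: w_def)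
    have fw: "fst (w j) = fst (U k j)" for j by (simp add: w_def del: P_op.simps)
    have zw: "relax_entropy M \<gamma> (w j) = - spec_entropy M (U k j)" for j
      using \<zeta>P U unfolding w_def by blast
    \<comment> \<open>At level k, \<rho>\<zeta> equals \<eta> because the data are equilibrium
      states. At the next level \<open>w'\<close> may be out of equilibrium, and
      \<open>eta_L_op_le\<close> gives the inequality in the direction required.\<close>
    have "eta M (U (Suc k) j) - eta M (U k j)
         + \<Delta>t k / \<Delta>x * (induced_entropy_flux M \<gamma> Z (U k j) (U k (j + 1)) n
                         - induced_entropy_flux M \<gamma> Z (U k (j - 1)) (U k j) n) \<le> 0" for j
      using r[of j] eta_L_op_le[OF mixture gamma O[of j]]
      unfolding U' fw zw
      by (simp add: eta_def induced_entropy_flux_def w_def del: P_op.simps)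
    \<comment> \<open>The change of sign turns the maximum of \<zeta> into a minimum of the specific
      entropy; applying \<open>L_op\<close> can only raise the left-hand side.\<close>
    moreover have "spec_entropy M (U (Suc k) j)
        \<ge> min (spec_entropy M (U k (j - 1))) (min (spec_entropy M (U k j)) (spec_entropy M (U k (j + 1))))" for j
      using z[of j] spec_entropy_L_op_ge[OF mixture gamma O[of j]]
      unfolding U' zw by linarith
    moreover have "U (Suc k) j \<in> Omega_a M" for j
      unfolding U' by (rule L_op_in_Omega_a[OF O])
    \<comment> \<open>Mass fractions depend only on the partial densities, which both maps preserve,
      so the bounds for \<open>w'\<close> carry over unchanged.\<close>
    moreover have "fst (U (Suc k) j) = fst (w' j)" for j
      unfolding U' by (rule fst_L_op)
    ultimately show ?thesis
      using y unfolding fw by (simp only: simp_thms)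
  qed
  show ?thesis
    by (rule conjI[OF lipschitz_induced_flux[OF mixture gamma H_lipschitz]
          conjI[OF cons conjI[OF conserv conjI[OF Q]]]])
       (intro allI impI, elim conjE, (rule scheme; assumption))
qed

end
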